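(* Let $N\ge 1$ be an integer and let $\mathcal{T}_N$ be the set of all polynomials $F(z)=\sum_{j=1}^{N}a_jz^{2j-1}$ with real coefficients $a_1,\dots,a_N$ and $a_1=1$ such that the polynomial $z\mapsto iF(-iz)$ is typically real. Put $$J_N=\min_{F\in\mathcal{T}_N}\bigl(-iF(i)\bigr)=\min_{F\in\mathcal{T}_N}\sum_{j=1}^{N}(-1)^{j+1}a_j$$ and $$F^{(0)}(z)=\sum_{j=1}^{N}\frac{U'_{2(N-j+1)}\left(\cos\frac{\pi}{2N+2}\right)}{U'_{2N}\left(\cos\frac{\pi}{2N+2}\right)}\,z^{2j-1}.$$ Then $F^{(0)}\in\mathcal{T}_N$, the minimum $J_N$ is attained, and for every $F\in\mathcal{T}_N$ $$J_N=\frac12\sec^2\frac{\pi}{2N+2}=-iF^{(0)}(i)\le -iF(i).$$ Moreover, the extremizer is unique: if $F\in\mathcal{T}_N$ and $-iF(i)=J_N$, then $F=F^{(0)}$.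
   Context: Here $i^2=-1$ and $\mathbb D=\{z\in\mathbb C:|z|<1\}$. A polynomial $f$ is called typically real if $f(z)$ is real for $z\in(-1,1)$ and $\operatorname{Im}\{f(z)\}\cdot\operatorname{Im}\{z\}>0$ at all other points $z$ of $\mathbb D$. $U_j$ denotes the Chebyshev polynomial of the second kind, $U_j(\cos t)=\frac{\sin((j+1)t)}{\sin t}$, and $U_j'$ denotes its derivative $\frac{d}{dx}U_j(x)$. For a polynomial $F(z)=\sum_{j=1}^N a_jz^{2j-1}$ with real coefficients one has $-iF(i)=\sum_{j=1}^{N}(-1)^{j+1}a_j$. *)

theory Defs
  imports "HOL-Analysis.Analysis" "HOL-Computational_Algebra.Polynomial"
begin

definition typically_real :: "complex poly \<Rightarrow> bool" where
  "typically_real f \<longleftrightarrow>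
     (\<forall>x::real. x \<in> {-1<..<1} \<longrightarrow> poly f (of_real x) \<in> \<real>) \<and>
     (\<forall>z\<in>ball 0 1 - complex_of_real ` {-1<..<1}. Im (poly f z) * Im z > 0)"

fun chebyshev_U :: "nat \<Rightarrow> real poly" where
  "chebyshev_U 0 = 1"
| "chebyshev_U (Suc 0) = [:0, 2:]"
| "chebyshev_U (Suc (Suc n)) = [:0, 2:] * chebyshev_U (Suc n) - chebyshev_U n"

text \<open>The recursion agrees with the trigonometric definition, and the latter determines
  the polynomial uniquely.\<close>

lemma chebyshev_U_mult_sin:
  "poly (chebyshev_U n) (cos t) * sin t = sin (real (n + 1) * t)"
proof (induction n rule: chebyshev_U.induct)
  case 1
  show ?case by simp
next
  case 2
  show ?case by (simp add: sin_double)
next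
  case (3 n)
  have "sin (real (Suc (Suc n) + 1) * t) + sin (real (n + 1) * t)
      = 2 * cos t * sin (real (Suc n + 1) * t)"
  proof -
    have "real (Suc (Suc n) + 1) * t = real (Suc n + 1) * t + t"
      and "real (n + 1) * t = real (Suc n + 1) * t - t"
      by (simp_all add: algebra_simps)
    then show ?thesis
      unfolding sin_add sin_diff by (simp only: sin_add sin_diff) simp
  qed
  moreover have "poly (chebyshev_U (Suc (Suc n))) (cos t) * sin t
      = 2 * cos t * (poly (chebyshev_U (Suc n)) (cos t) * sin t)
        - poly (chebyshev_U n) (cos t) * sin t"
    by (simp add: algebra_simps)
  ultimately show ?case
    using 3 by simp
qed

lemma chebyshev_U_cos:
  "sin t \<noteq> 0 \<Longrightarrow> poly (chebyshev_U n) (cos t) = sin (real (n + 1) * t) / sin t"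
  using chebyshev_U_mult_sin[of n t] by (simp add: field_simps)

lemma chebyshev_U_unique:
  assumes "\<And>t. sin t \<noteq> 0 \<Longrightarrow> poly p (cos t) = sin (real (n + 1) * t) / sin t"
  shows "p = chebyshev_U n"
proof (rule ccontr)
  assume ne: "p \<noteq> chebyshev_U n"
  have "x \<in> {x. poly (p - chebyshev_U n) x = 0}" if "x \<in> {-1<..<1}" for x
  proof -
    have "sin (arccos x) \<noteq> 0" "cos (arccos x) = x"
      using that sin_arccos_nonzero[of x] by auto
    then show ?thesis
      using assms[of "arccos x"] chebyshev_U_cos[of "arccos x" n] by simp
  qed
  then have "{-1<..<1} \<subseteq> {x. poly (p - chebyshev_U n) x = 0}" by blast
  moreover have "finite {x. poly (p - chebyshev_U n) x = 0}"
    using ne by (intro poly_roots_finite) simp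
  ultimately have "finite {-1<..<1::real}"
    by (rule finite_subset)
  then show False
    using infinite_Ioo[of "-1" "1::real"] by simp
qed

text \<open>\<open>a j\<close> is the coefficient of \<open>z ^ (2 * j - 1)\<close>; values of \<open>a\<close> outside \<open>{1..N}\<close> are
  irrelevant.\<close>

definition odd_poly :: "nat \<Rightarrow> (nat \<Rightarrow> real) \<Rightarrow> complex poly" where
  "odd_poly N a = (\<Sum>j=1..N. monom (of_real (a j)) (2 * j - 1))"

lemma poly_odd_poly:
  "poly (odd_poly N a) z = (\<Sum>j=1..N. of_real (a j) * z ^ (2 * j - 1))"
  by (simp add: odd_poly_def poly_sum poly_monom)

lemma odd_poly_at_ii:
  "- \<i> * poly (odd_poly N a) \<i> = of_real (\<Sum>j=1..N. (-1) ^ (j + 1) * a j)"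
proof -
  have "- \<i> * (of_real (a j) * \<i> ^ (2 * j - 1)) = of_real ((-1) ^ (j + 1) * a j)"
    if "j \<in> {1..N}" for j
  proof -
    have "j = Suc (j - 1)" using that by simp
    then obtain k where "j = Suc k" by blast
    then show ?thesis by (simp add: power_mult mult.left_commute)
  qed
  then show ?thesis
    unfolding poly_odd_poly sum_distrib_left of_real_sum by (rule sum.cong[OF refl])
qed

text \<open>Composition with \<open>[:0, - \<i>:]\<close> is the substitution of \<open>- \<i> * z\<close> for \<open>z\<close>.\<close>

definition T_set :: "nat \<Rightarrow> complex poly set" where
  "T_set N = {F. (\<exists>a. a 1 = 1 \<and> F = odd_poly N a) \<and>
                 typically_real (smult \<i> (pcompose F [:0, - \<i>:]))}"

text \<open>The minimum as the least real number among the values, which are real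
  by \<open>odd_poly_at_ii\<close>.\<close>

definition J_min :: "nat \<Rightarrow> real" where
  "J_min N = (LEAST m. \<exists>F\<in>T_set N. - \<i> * poly F \<i> = of_real m)"

definition F_ext :: "nat \<Rightarrow> complex poly" where
  "F_ext N = odd_poly N (\<lambda>j.
     poly (pderiv (chebyshev_U (2 * (N - j + 1)))) (cos (pi / (2 * real N + 2))) /
     poly (pderiv (chebyshev_U (2 * N))) (cos (pi / (2 * real N + 2))))"

end

theory Submission
  imports Defs "HOL-Complex_Analysis.Conformal_Mappings"
begin

text \<open>The problem is Fejer's sharp bound for the first coefficient of a nonnegative cosine
  polynomial in disguise.

  After the rotation of the variable, typical reality of \<open>z \<mapsto> \<i> F(- \<i> z)\<close> says that
  \<open>Re F(w)\<close> and \<open>Re w\<close> have the same strict sign in the unit disc off the imaginary axis. Every real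
  sequence \<open>a\<^sub>1, \<dots>, a\<^sub>N\<close> can be written as \<open>a\<^sub>j = r\<^sub>j\<^sub>-\<^sub>1 + r\<^sub>j\<close> with \<open>r\<^sub>N = 0\<close>, and then
  \<open>Re F(e\<^sup>i\<^sup>s) = cos s * R(2 s)\<close> with the cosine polynomial \<open>R(\<psi>) = r\<^sub>0 + 2 \<Sum> r\<^sub>m cos (m \<psi>)\<close>.
  Radial limits in one direction, and the minimum principle on the right half disc in the other, show
  that \<open>F\<close> is admissible exactly if \<open>R \<ge> 0\<close> (\<open>odd_poly_in_T_set_iff\<close>). In these coordinates the
  normalization is \<open>r\<^sub>0 + r\<^sub>1 = 1\<close> and the functional \<open>- \<i> F(\<i>)\<close> is \<open>r\<^sub>0\<close>.

  Put \<open>\<alpha> = pi / (N + 1)\<close>. Fejer's inequality \<open>r\<^sub>1 \<le> r\<^sub>0 cos \<alpha>\<close> gives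
  \<open>r\<^sub>0 \<ge> 1 / (1 + cos \<alpha>) = sec\<^sup>2 (\<alpha> / 2) / 2\<close>. It holds because \<open>r\<^sub>0 cos \<alpha> - r\<^sub>1\<close> is the mean of
  \<open>(cos \<alpha> - cos \<psi>) R(\<psi>)\<close> over the \<open>N + 1\<close> equidistant points that are the odd multiples of \<open>\<alpha>\<close>
  (\<open>fejer_quadrature\<close>): the product has degree at most \<open>N\<close>, too small for these points to alias, and
  on them \<open>cos \<psi> \<le> cos \<alpha>\<close>.

  In the case of equality \<open>R\<close> vanishes at all of these points other than \<open>\<plusminus> \<alpha>\<close>, and there \<open>R' = 0\<close> as well,
  since \<open>R\<close> has a minimum. The discrete Fourier coefficients of \<open>R\<close> and \<open>R'\<close> at these points are then
  known up to one factor each, and the two together determine every \<open>r\<^sub>m\<close> (\<open>fejer_equality\<close>): up to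
  scaling \<open>r\<close> is \<open>fejer_coeff\<close>. Up to a factor, these numbers are the autocorrelation of the
  sequence \<open>sin \<alpha>, sin (2 \<alpha>), \<dots>, sin (N \<alpha>)\<close>, so their cosine polynomial is a squared modulus and is
  nonnegative; and their adjacent sums are proportional to the derivatives of Chebyshev polynomials
  that define the extremal polynomial (\<open>fejer_coeff_pair\<close>).\<close>

section \<open>Discrete Fourier coefficients of a cosine polynomial\<close>

definition cosine_poly :: "(nat \<Rightarrow> real) \<Rightarrow> nat \<Rightarrow> real \<Rightarrow> real" where
  "cosine_poly r n \<psi> = r 0 + 2 * (\<Sum>m=1..n. r m * cos (real m * \<psi>))"

lemma sum_cos_arith:
  "2 * sin a * (\<Sum>i<n. cos (b + 2 * real i * a)) = sin (b + (2 * real n - 1) * a) - sin (b - a)"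
proof (induction n)
  case (Suc n)
  have "2 * sin a * cos (b + 2 * real n * a)
      = sin (b + (2 * real (Suc n) - 1) * a) - sin (b + (2 * real n - 1) * a)"
  proof -
    have "a + (b + 2 * real n * a) = b + (2 * real (Suc n) - 1) * a"
      "a - (b + 2 * real n * a) = - (b + (2 * real n - 1) * a)"
      by (simp_all add: algebra_simps)
    then show ?thesis
      by (simp only: mult.assoc[of 2 "sin a"] sin_times_cos sin_minus) simp
  qed
  with Suc show ?case by (simp add: algebra_simps)
qed simp

text \<open>The odd multiples of \<open>pi / M\<close>; for \<open>k < M\<close> they are equidistant on the circle and symmetric
  under \<open>\<psi> \<mapsto> 2 * pi - \<psi>\<close>.\<close>

definition node :: "nat \<Rightarrow> nat \<Rightarrow> real" where
  "node M k = (2 * real k + 1) * (pi / real M)"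

text \<open>A frequency that is not a multiple of \<open>M\<close> averages to zero. Frequency \<open>M\<close> itself does not: it takes
  the value \<open>-1\<close> at every node, and this alias is what couples \<open>r j\<close> with \<open>r (M - j)\<close> below.\<close>

lemma sum_cos_node:
  fixes d :: int
  assumes "M > 0" "\<bar>d\<bar> < 2 * int M"
  shows "(\<Sum>k<M. cos (of_int d * node M k))
    = real M * (of_bool (d = 0) - of_bool (\<bar>d\<bar> = int M))"
proof -
  define \<beta> where "\<beta> = of_int d * (pi / real M)"
  have nd: "cos (of_int d * node M k) = cos ((2 * real k + 1) * \<beta>)" for k
    by (simp add: node_def \<beta>_def mult_ac)
  consider "d = 0" | "\<bar>d\<bar> = int M" | "d \<noteq> 0" "\<bar>d\<bar> \<noteq> int M" by blast
  then show ?thesis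
  proof cases
    case 1
    then show ?thesis using assms by simp
  next
    case 2
    then have "\<beta> = pi \<or> \<beta> = - pi"
    proof (cases "d < 0")
      case True
      with 2 have "d = - int M" by simp
      then show ?thesis using assms by (simp add: \<beta>_def)
    next
      case False
      with 2 have "d = int M" by simp
      then show ?thesis using assms by (simp add: \<beta>_def)
    qed
    moreover have "cos ((2 * real k + 1) * pi) = -1" for k
      by (metis add.commute cos_npi minus_one_power_iff odd_two_times_div_two_succ of_nat_1
          of_nat_Suc of_nat_add of_nat_mult of_nat_numeral even_Suc even_mult_iff even_numeral plus_1_eq_Suc)
    ultimately have "cos ((2 * real k + 1) * \<beta>) = -1" for k
      by (metis cos_minus mult_minus_right)
    then show ?thesis using 2 assms by (simp add: nd)
  next
    case 3
    have "sin \<beta> \<noteq> 0"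
    proof
      assume "sin \<beta> = 0"
      then obtain i :: int where "\<beta> = of_int i * pi"
        by (auto simp: sin_zero_iff_int2)
      then have "of_int d = (of_int (i * int M) :: real)"
        using assms by (simp add: \<beta>_def field_simps)
      then have d: "d = i * int M" by linarith
      then have "\<bar>i\<bar> * int M < 2 * int M" "\<bar>i\<bar> * int M \<noteq> 0" "\<bar>i\<bar> * int M \<noteq> int M"
        using assms 3 by (auto simp: abs_mult)
      then have "\<bar>i\<bar> < 2" "\<bar>i\<bar> \<noteq> 0" "\<bar>i\<bar> \<noteq> 1" by auto
      then show False by linarith
    qed
    moreover have "sin (2 * real M * \<beta>) = 0"
      using assms sin_zero_iff_int2[of "2 * real M * \<beta>"]
      by (auto simp: \<beta>_def intro!: exI[of _ "2 * d"])
    ultimately have "(\<Sum>k<M. cos ((2 * real k + 1) * \<beta>)) = 0"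
      using sum_cos_arith[where a = \<beta> and b = \<beta> and n = M] by (simp add: algebra_simps)
    then show ?thesis using 3 by (simp add: nd)
  qed
qed

lemma sum_cos_node_diff_add:
  assumes "1 \<le> j" "j \<le> N" "m \<le> N"
  shows "(\<Sum>k<Suc N. cos (of_int (int m - int j) * node (Suc N) k)) = real (Suc N) * of_bool (m = j)"
    and "(\<Sum>k<Suc N. cos (of_int (int m + int j) * node (Suc N) k))
        = - real (Suc N) * of_bool (m = Suc N - j)"
proof -
  have "(int m - int j = 0) = (m = j)" "(\<bar>int m - int j\<bar> = int (Suc N)) = False"
    "(int m + int j = 0) = False" "(\<bar>int m + int j\<bar> = int (Suc N)) = (m = Suc N - j)"
    using assms by auto
  note eqs = this
  have bounds: "\<bar>int m - int j\<bar> < 2 * int (Suc N)" "\<bar>int m + int j\<bar> < 2 * int (Suc N)"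
    using assms by auto
  show "(\<Sum>k<Suc N. cos (of_int (int m - int j) * node (Suc N) k)) = real (Suc N) * of_bool (m = j)"
    unfolding sum_cos_node[OF zero_less_Suc bounds(1)] eqs by simp
  show "(\<Sum>k<Suc N. cos (of_int (int m + int j) * node (Suc N) k))
      = - real (Suc N) * of_bool (m = Suc N - j)"
    unfolding sum_cos_node[OF zero_less_Suc bounds(2)] eqs by simp
qed

lemma sum_cos_cos_node:
  assumes "1 \<le> j" "j \<le> N" "m \<le> N"
  shows "(\<Sum>k<Suc N. cos (real m * node (Suc N) k) * cos (real j * node (Suc N) k))
    = real (Suc N) / 2 * (of_bool (m = j) - of_bool (m = Suc N - j))"
proof -
  have "(\<Sum>k<Suc N. cos (real m * node (Suc N) k) * cos (real j * node (Suc N) k))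
    = ((\<Sum>k<Suc N. cos (of_int (int m - int j) * node (Suc N) k))
      + (\<Sum>k<Suc N. cos (of_int (int m + int j) * node (Suc N) k))) / 2"
    unfolding sum.distrib[symmetric] sum_divide_distrib
    by (intro sum.cong refl) (simp add: cos_times_cos left_diff_distrib distrib_right)
  also have "\<dots> = real (Suc N) / 2 * (of_bool (m = j) - of_bool (m = Suc N - j))"
    unfolding sum_cos_node_diff_add[OF assms] by (simp add: field_simps)
  finally show ?thesis .
qed

lemma sum_sin_sin_node:
  assumes "1 \<le> j" "j \<le> N" "m \<le> N"
  shows "(\<Sum>k<Suc N. sin (real m * node (Suc N) k) * sin (real j * node (Suc N) k))
    = real (Suc N) / 2 * (of_bool (m = j) + of_bool (m = Suc N - j))"
proof -
  have "(\<Sum>k<Suc N. sin (real m * node (Suc N) k) * sin (real j * node (Suc N) k))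
    = ((\<Sum>k<Suc N. cos (of_int (int m - int j) * node (Suc N) k))
      - (\<Sum>k<Suc N. cos (of_int (int m + int j) * node (Suc N) k))) / 2"
    unfolding sum_subtractf[symmetric] sum_divide_distrib
    by (intro sum.cong refl) (simp add: sin_times_sin left_diff_distrib distrib_right)
  also have "\<dots> = real (Suc N) / 2 * (of_bool (m = j) + of_bool (m = Suc N - j))"
    unfolding sum_cos_node_diff_add[OF assms] by (simp add: field_simps)
  finally show ?thesis .
qed

lemma sum_of_bool_pick:
  fixes f :: "nat \<Rightarrow> real"
  assumes "finite A" "i \<in> A"
  shows "(\<Sum>m\<in>A. f m * of_bool (m = i)) = f i"
  using assms by (simp add: of_bool_def if_distrib sum.delta' cong: if_cong)

lemma node_mean:
  "(\<Sum>k<Suc N. cosine_poly r N (node (Suc N) k)) = real (Suc N) * r 0"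
proof -
  have "(\<Sum>k<Suc N. \<Sum>m=1..N. r m * cos (real m * node (Suc N) k))
      = (\<Sum>m=1..N. r m * (\<Sum>k<Suc N. cos (of_int (int m) * node (Suc N) k)))"
    by (subst sum.swap) (simp add: sum_distrib_left del: sum.lessThan_Suc)
  also have "\<dots> = 0"
    by (intro sum.neutral ballI, subst sum_cos_node) auto
  finally show ?thesis
    unfolding cosine_poly_def sum.distrib sum_distrib_left[symmetric] by simp
qed

text \<open>The node sums see only \<open>r j - r (M - j)\<close> where \<open>M = N + 1\<close>. The derivative, whose sine terms
  alias with the opposite sign and carry the weights \<open>j\<close> and \<open>M - j\<close>, supplies an independent second
  combination of the same two numbers in \<open>node_deriv_sin_coeff\<close>.\<close>

lemma node_cos_coeff:
  assumes "1 \<le> j" "j \<le> N"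
  shows "(\<Sum>k<Suc N. cosine_poly r N (node (Suc N) k) * cos (real j * node (Suc N) k))
    = real (Suc N) * (r j - r (Suc N - j))"
proof -
  have "(\<Sum>k<Suc N. cosine_poly r N (node (Suc N) k) * cos (real j * node (Suc N) k))
    = r 0 * (\<Sum>k<Suc N. cos (real 0 * node (Suc N) k) * cos (real j * node (Suc N) k))
      + 2 * (\<Sum>k<Suc N. \<Sum>m=1..N. r m * (cos (real m * node (Suc N) k) * cos (real j * node (Suc N) k)))"
    by (simp add: cosine_poly_def algebra_simps sum.distrib sum_distrib_left del: sum.lessThan_Suc)
  also have "(\<Sum>k<Suc N. \<Sum>m=1..N. r m * (cos (real m * node (Suc N) k) * cos (real j * node (Suc N) k)))
    = (\<Sum>m=1..N. r m * (\<Sum>k<Suc N. cos (real m * node (Suc N) k) * cos (real j * node (Suc N) k)))"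
    by (subst sum.swap) (simp add: sum_distrib_left del: sum.lessThan_Suc)
  also have "\<dots> = (\<Sum>m=1..N. r m * (real (Suc N) / 2 * (of_bool (m = j) - of_bool (m = Suc N - j))))"
    using assms by (intro sum.cong[OF refl], subst sum_cos_cos_node) auto
  also have "\<dots> = real (Suc N) / 2 * ((\<Sum>m=1..N. r m * of_bool (m = j))
      - (\<Sum>m=1..N. r m * of_bool (m = Suc N - j)))"
    unfolding right_diff_distrib sum_distrib_left sum_subtractf[symmetric]
    by (intro sum.cong refl) (simp add: algebra_simps)
  also have "\<dots> = real (Suc N) / 2 * (r j - r (Suc N - j))"
    using assms by (subst (1 2) sum_of_bool_pick) auto
  finally show ?thesis
    using assms by (subst (asm) sum_cos_cos_node) auto
qed

definition cosine_poly_deriv :: "(nat \<Rightarrow> real) \<Rightarrow> nat \<Rightarrow> real \<Rightarrow> real" where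
  "cosine_poly_deriv r n \<psi> = - 2 * (\<Sum>m=1..n. real m * r m * sin (real m * \<psi>))"

lemma cosine_poly_has_derivative:
  "(cosine_poly r n has_real_derivative cosine_poly_deriv r n \<psi>) (at \<psi>)"
proof -
  have "((\<lambda>\<psi>. r m * cos (real m * \<psi>)) has_real_derivative - (real m * r m * sin (real m * \<psi>))) (at \<psi>)" for m
    by (auto intro!: derivative_eq_intros)
  then have "((\<lambda>\<psi>. \<Sum>m=1..n. r m * cos (real m * \<psi>)) has_real_derivative
      (\<Sum>m=1..n. - (real m * r m * sin (real m * \<psi>)))) (at \<psi>)"
    by (intro DERIV_sum)
  then have "((\<lambda>\<psi>. r 0 + 2 * (\<Sum>m=1..n. r m * cos (real m * \<psi>))) has_real_derivative
      0 + 2 * (\<Sum>m=1..n. - (real m * r m * sin (real m * \<psi>)))) (at \<psi>)"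
    by (intro DERIV_add DERIV_const DERIV_cmult)
  then show ?thesis
    unfolding cosine_poly_def cosine_poly_deriv_def by (simp add: sum_negf)
qed

lemma node_deriv_sin_coeff:
  assumes "1 \<le> j" "j \<le> N"
  shows "(\<Sum>k<Suc N. cosine_poly_deriv r N (node (Suc N) k) * sin (real j * node (Suc N) k))
    = - real (Suc N) * (real j * r j + real (Suc N - j) * r (Suc N - j))"
proof -
  have "(\<Sum>k<Suc N. cosine_poly_deriv r N (node (Suc N) k) * sin (real j * node (Suc N) k))
    = - 2 * (\<Sum>k<Suc N. \<Sum>m=1..N. real m * r m * (sin (real m * node (Suc N) k) * sin (real j * node (Suc N) k)))"
    by (simp add: cosine_poly_deriv_def sum_distrib_left sum_distrib_right mult_ac del: sum.lessThan_Suc)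
  also have "(\<Sum>k<Suc N. \<Sum>m=1..N. real m * r m * (sin (real m * node (Suc N) k) * sin (real j * node (Suc N) k)))
    = (\<Sum>m=1..N. real m * r m * (\<Sum>k<Suc N. sin (real m * node (Suc N) k) * sin (real j * node (Suc N) k)))"
    by (subst sum.swap) (simp add: sum_distrib_left del: sum.lessThan_Suc)
  also have "\<dots> = (\<Sum>m=1..N. real m * r m * (real (Suc N) / 2 * (of_bool (m = j) + of_bool (m = Suc N - j))))"
    using assms by (intro sum.cong[OF refl], subst sum_sin_sin_node) auto
  also have "\<dots> = real (Suc N) / 2 * ((\<Sum>m=1..N. (real m * r m) * of_bool (m = j))
      + (\<Sum>m=1..N. (real m * r m) * of_bool (m = Suc N - j)))"
    unfolding distrib_left sum_distrib_left sum.distrib[symmetric]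
    by (intro sum.cong refl) (simp add: algebra_simps)
  also have "\<dots> = real (Suc N) / 2 * (real j * r j + real (Suc N - j) * r (Suc N - j))"
    using assms by (subst (1 2) sum_of_bool_pick) auto
  finally show ?thesis by (simp del: sum.lessThan_Suc of_nat_Suc)
qed

section \<open>Fejer's coefficient inequality and its equality case\<close>

lemma last_node: "node (Suc N) N = 2 * pi - pi / real (Suc N)"
  by (simp add: node_def field_simps)

text \<open>By the product formula the difference of the two cosines is
  \<open>2 * sin ((k + 1) * \<alpha>) * sin (k * \<alpha>)\<close> with \<open>\<alpha> = pi / (N + 1)\<close>.\<close>

lemma cos_node_less:
  assumes "0 < k" "k < N"
  shows "cos (node (Suc N) k) < cos (pi / real (Suc N))"
proof -
  let ?\<alpha> = "pi / real (Suc N)"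
  have "cos ?\<alpha> - cos (node (Suc N) k) = 2 * sin (real (Suc k) * ?\<alpha>) * sin (real k * ?\<alpha>)"
  proof -
    have "(?\<alpha> + node (Suc N) k) / 2 = real (Suc k) * ?\<alpha>" "(node (Suc N) k - ?\<alpha>) / 2 = real k * ?\<alpha>"
      unfolding node_def of_nat_Suc by algebra+
    then show ?thesis by (simp only: cos_diff_cos)
  qed
  moreover have "sin (real i * ?\<alpha>) > 0" if "0 < i" "i < Suc N" for i
    using that mult_strict_left_mono[of "real i" "real (Suc N)" pi]
    by (intro sin_gt_zero) (simp_all add: field_simps)
  ultimately have "cos ?\<alpha> - cos (node (Suc N) k) > 0"
    using assms by (simp only: mult_pos_pos zero_less_numeral Suc_mono less_SucI zero_less_Suc)
  then show ?thesis by simp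
qed

lemma cos_node_le:
  assumes "k \<le> N"
  shows "cos (node (Suc N) k) \<le> cos (pi / real (Suc N))"
proof -
  consider "k = 0" | "k = N" | "0 < k" "k < N" using assms by linarith
  then show ?thesis
  proof cases
    case 2
    then show ?thesis by (simp only: last_node cos_2pi_minus)
  qed (use cos_node_less[of k N] in \<open>auto simp: node_def\<close>)
qed

text \<open>This is the difference of \<open>node_mean\<close>, multiplied by the cosine, and \<open>node_cos_coeff\<close> for \<open>j = 1\<close>,
  where \<open>r N = 0\<close> removes the alias of \<open>r 1\<close>.\<close>

lemma fejer_quadrature:
  assumes "N \<ge> 1" "r N = 0"
  shows "(\<Sum>k<Suc N. (cos (pi / real (Suc N)) - cos (node (Suc N) k)) * cosine_poly r N (node (Suc N) k))
    = real (Suc N) * (cos (pi / real (Suc N)) * r 0 - r 1)"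
proof -
  have "(\<Sum>k<Suc N. (cos (pi / real (Suc N)) - cos (node (Suc N) k)) * cosine_poly r N (node (Suc N) k))
    = cos (pi / real (Suc N)) * (\<Sum>k<Suc N. cosine_poly r N (node (Suc N) k))
      - (\<Sum>k<Suc N. cosine_poly r N (node (Suc N) k) * cos (real 1 * node (Suc N) k))"
    unfolding sum_distrib_left sum_subtractf[symmetric]
    by (intro sum.cong refl) (simp add: algebra_simps)
  also have "\<dots> = real (Suc N) * (cos (pi / real (Suc N)) * r 0 - r 1)"
    using assms by (subst node_mean, subst node_cos_coeff) (simp_all add: right_diff_distrib mult_ac)
  finally show ?thesis .
qed

lemma fejer_inequality:
  assumes "N \<ge> 1" "r N = 0" and nonneg: "\<And>\<psi>. cosine_poly r N \<psi> \<ge> 0"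
  shows "r 1 \<le> cos (pi / real (Suc N)) * r 0"
proof -
  have "0 \<le> real (Suc N) * (cos (pi / real (Suc N)) * r 0 - r 1)"
    unfolding fejer_quadrature[of N r, OF assms(1,2), symmetric]
    using cos_node_le nonneg by (intro sum_nonneg mult_nonneg_nonneg) (auto simp: less_Suc_eq_le)
  then show ?thesis by (simp add: zero_le_mult_iff)
qed

text \<open>Up to a factor, the classical coefficients of Fejer's extremal cosine polynomial.\<close>

definition fejer_coeff :: "nat \<Rightarrow> nat \<Rightarrow> real" where
  "fejer_coeff N m = (real (Suc N) - real m) * cos (real m * (pi / real (Suc N))) * sin (pi / real (Suc N))
     + sin (real m * (pi / real (Suc N))) * cos (pi / real (Suc N))"

text \<open>All summands of the quadrature vanish, so only the nodes \<open>\<alpha>\<close> and \<open>2 * pi - \<alpha>\<close> contribute to the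
  Fourier sums of \<open>R\<close> and \<open>R'\<close>. At these two nodes \<open>cos (j * \<psi>)\<close> and \<open>sin (j * \<psi>) / sin \<psi>\<close> take equal
  values, hence the \<open>j\<close>-th sum is a known multiple of the mean of \<open>R\<close>, respectively of the first sine
  sum of \<open>R'\<close>, which is \<open>- (N + 1) * r 1\<close>. The resulting linear system for \<open>r j\<close> and \<open>r (N + 1 - j)\<close> is
  uniquely solvable.\<close>

lemma fejer_equality:
  assumes N: "N \<ge> 1" and rN: "r N = 0" and nonneg: "\<And>\<psi>. cosine_poly r N \<psi> \<ge> 0"
    and eq: "r 1 = cos (pi / real (Suc N)) * r 0" and jN: "j \<le> N"
  shows "real (Suc N) * sin (pi / real (Suc N)) * r j = r 0 * fejer_coeff N j"
proof (cases "j = 0")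
  case True
  then show ?thesis by (simp add: fejer_coeff_def)
next
  case False
  define \<alpha> where "\<alpha> = pi / real (Suc N)"
  let ?R = "\<lambda>k. cosine_poly r N (node (Suc N) k)"
  let ?D = "\<lambda>k. cosine_poly_deriv r N (node (Suc N) k)"
  have summand_0: "(cos \<alpha> - cos (node (Suc N) k)) * ?R k = 0" if "k < Suc N" for k
  proof -
    have "(\<Sum>k<Suc N. (cos \<alpha> - cos (node (Suc N) k)) * ?R k) = 0"
      using fejer_quadrature[of N r, OF N rN] eq by (simp add: \<alpha>_def)
    moreover have "(cos \<alpha> - cos (node (Suc N) k)) * ?R k \<ge> 0" if "k \<in> {..<Suc N}" for k
      using that nonneg cos_node_le[of k N] by (intro mult_nonneg_nonneg) (auto simp: \<alpha>_def)
    ultimately show ?thesis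
      using that sum_nonneg_eq_0_iff[of "{..<Suc N}" "\<lambda>k. (cos \<alpha> - cos (node (Suc N) k)) * ?R k"]
      by blast
  qed
  have R0: "?R k = 0" if "0 < k" "k < N" for k
    using summand_0[of k] cos_node_less[OF that] that by (simp add: \<alpha>_def)
  have D0: "?D k = 0" if "0 < k" "k < N" for k
    using DERIV_local_min[OF cosine_poly_has_derivative, of 1 "node (Suc N) k" r N] R0[OF that] nonneg by simp
  have nodeN: "real j * node (Suc N) N = 2 * real j * pi - real j * \<alpha>" for j
    by (simp only: last_node) (simp add: \<alpha>_def algebra_simps)
  have cosN: "cos (real j * node (Suc N) N) = cos (real j * \<alpha>)"
    and sinN: "sin (real j * node (Suc N) N) = - sin (real j * \<alpha>)" for j
    by (simp_all add: nodeN cos_diff sin_diff del: of_nat_Suc)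
  have node0: "node (Suc N) 0 = \<alpha>" by (simp add: node_def \<alpha>_def)
  \<comment> \<open>Here and in \<open>sin_j\<close>, nodes other than the first and the last contribute zero on both sides.\<close>
  have cos_j: "?R k * cos (real j * node (Suc N) k) = ?R k * cos (real j * \<alpha>)" if k: "k < Suc N" for k
  proof -
    consider "k = 0" | "k = N" | "0 < k" "k < N" using k by linarith
    then show ?thesis
    proof cases
      case 1
      then show ?thesis by (simp add: node0)
    next
      case 2
      then show ?thesis by (simp only: cosN)
    next
      case 3
      then show ?thesis by (simp only: R0)
    qed
  qed
  have sin_j: "?D k * sin (real j * node (Suc N) k) * sin \<alpha>
      = ?D k * sin (real 1 * node (Suc N) k) * sin (real j * \<alpha>)"
    if k: "k < Suc N" for k
  proof -
    consider "k = 0" | "k = N" | "0 < k" "k < N" using k by linarith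
    then show ?thesis
    proof cases
      case 1
      then show ?thesis by (simp add: node0)
    next
      case 2
      then show ?thesis using sinN[of 1] sinN[of j] by simp
    next
      case 3
      then show ?thesis by (simp only: D0)
    qed
  qed
  have "real (Suc N) * (r j - r (Suc N - j)) = (\<Sum>k<Suc N. ?R k * cos (real j * node (Suc N) k))"
    using False jN by (subst node_cos_coeff) auto
  also have "\<dots> = (\<Sum>k<Suc N. ?R k * cos (real j * \<alpha>))"
    by (intro sum.cong refl cos_j) simp
  also have "\<dots> = real (Suc N) * r 0 * cos (real j * \<alpha>)"
    unfolding sum_distrib_right[symmetric] node_mean ..
  finally have "real (Suc N) * (r j - r (Suc N - j)) = real (Suc N) * (r 0 * cos (real j * \<alpha>))"
    by (simp only: mult.assoc)
  then have 1: "r (Suc N - j) = r j - r 0 * cos (real j * \<alpha>)"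
    by (subst (asm) mult_cancel_left) simp
  have "(\<Sum>k<Suc N. ?D k * sin (real j * node (Suc N) k)) * sin \<alpha>
      = (\<Sum>k<Suc N. ?D k * sin (real 1 * node (Suc N) k)) * sin (real j * \<alpha>)"
    unfolding sum_distrib_right by (intro sum.cong refl sin_j) simp
  moreover have "(\<Sum>k<Suc N. ?D k * sin (real j * node (Suc N) k))
      = - real (Suc N) * (real j * r j + real (Suc N - j) * r (Suc N - j))"
    using False jN by (intro node_deriv_sin_coeff) auto
  moreover have "(\<Sum>k<Suc N. ?D k * sin (real 1 * node (Suc N) k)) = - real (Suc N) * r 1"
    using node_deriv_sin_coeff[of 1 N r] N rN by (simp del: sum.lessThan_Suc of_nat_Suc)
  ultimately have "- real (Suc N) * ((real j * r j + real (Suc N - j) * r (Suc N - j)) * sin \<alpha>)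
      = - real (Suc N) * (r 1 * sin (real j * \<alpha>))"
    by (simp only: mult.assoc)
  then have "(real j * r j + real (Suc N - j) * r (Suc N - j)) * sin \<alpha> = r 1 * sin (real j * \<alpha>)"
    by (subst (asm) mult_cancel_left) simp
  then show ?thesis
    using jN unfolding fejer_coeff_def 1 eq \<alpha>_def[symmetric]
        by (simp add: of_nat_diff) (simp add: algebra_simps)
qed

section \<open>Nonnegativity of the extremal cosine polynomial\<close>

definition autocorr :: "(nat \<Rightarrow> real) \<Rightarrow> nat \<Rightarrow> nat \<Rightarrow> real" where
  "autocorr x n m = (\<Sum>i<n - m. x i * x (i + m))"

lemma autocorr_Suc: "m \<le> n \<Longrightarrow> autocorr x (Suc n) m = autocorr x n m + x (n - m) * x n"
  by (simp add: autocorr_def Suc_diff_le)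

lemma autocorr_eq_0: "n \<le> m \<Longrightarrow> autocorr x n m = 0"
  by (simp add: autocorr_def)

text \<open>The easy half of the Fejer--Riesz theorem: the cosine polynomial of an autocorrelation is the squared
  modulus of \<open>\<Sum>i<n. x i * cis (i * \<psi>)\<close>.\<close>

lemma cosine_poly_autocorr:
  "cosine_poly (autocorr x n) n \<psi>
    = (\<Sum>i<n. x i * cos (real i * \<psi>))\<^sup>2 + (\<Sum>i<n. x i * sin (real i * \<psi>))\<^sup>2"
proof (induction n)
  case 0
  then show ?case by (simp add: cosine_poly_def autocorr_def)
next
  case (Suc n)
  let ?C = "\<Sum>i<n. x i * cos (real i * \<psi>)" and ?S = "\<Sum>i<n. x i * sin (real i * \<psi>)"
  have "(\<Sum>m=1..n. x (n - m) * x n * cos (real m * \<psi>)) = (\<Sum>i<n. x i * x n * cos ((real n - real i) * \<psi>))"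
    by (rule sum.reindex_bij_witness[of _ "\<lambda>i. n - i" "\<lambda>m. n - m"]) (auto simp: of_nat_diff)
  also have "\<dots> = x n * (cos (real n * \<psi>) * ?C + sin (real n * \<psi>) * ?S)"
    by (simp add: left_diff_distrib cos_diff sum_distrib_left sum.distrib algebra_simps)
  finally have new: "(\<Sum>m=1..n. x (n - m) * x n * cos (real m * \<psi>))
      = x n * (cos (real n * \<psi>) * ?C + sin (real n * \<psi>) * ?S)" .
  have "cosine_poly (autocorr x (Suc n)) (Suc n) \<psi> = cosine_poly (autocorr x n) n \<psi> + x n * x n
      + 2 * (\<Sum>m=1..n. x (n - m) * x n * cos (real m * \<psi>))"
    by (simp add: cosine_poly_def autocorr_eq_0 autocorr_Suc sum.distrib distrib_left distrib_right)
  also have "\<dots> = ?C\<^sup>2 + ?S\<^sup>2 + x n * x n * ((cos (real n * \<psi>))\<^sup>2 + (sin (real n * \<psi>))\<^sup>2)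
      + 2 * (x n * (cos (real n * \<psi>) * ?C + sin (real n * \<psi>) * ?S))"
    unfolding new Suc sin_cos_squared_add2 by simp
  also have "\<dots> = (?C + x n * cos (real n * \<psi>))\<^sup>2 + (?S + x n * sin (real n * \<psi>))\<^sup>2"
    by algebra
  finally show ?case by simp
qed

text \<open>The product formula turns each summand \<open>sin ((i + 1) * \<alpha>) * sin ((i + 1 + m) * \<alpha>)\<close> into a constant and a
  term of an arithmetic cosine sum, and \<open>(N + 1) * \<alpha> = pi\<close> closes the latter up.\<close>

lemma fejer_coeff_eq_autocorr:
  assumes "N \<ge> 1" "m \<le> N"
  shows "fejer_coeff N m
    = 2 * sin (pi / real (Suc N)) * autocorr (\<lambda>i. sin (real (Suc i) * (pi / real (Suc N)))) N m"
proof -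
  define \<alpha> where "\<alpha> = pi / real (Suc N)"
  have M\<alpha>: "real (Suc N) * \<alpha> = pi" by (simp add: \<alpha>_def del: of_nat_Suc)
  have "2 * sin \<alpha> * (\<Sum>i<N - m. cos (real (m + 2) * \<alpha> + 2 * real i * \<alpha>))
      = sin (real (m + 2) * \<alpha> + (2 * real (N - m) - 1) * \<alpha>) - sin (real (m + 2) * \<alpha> - \<alpha>)"
    by (rule sum_cos_arith)
  also have "real (m + 2) * \<alpha> + (2 * real (N - m) - 1) * \<alpha> = 2 * (real (Suc N) * \<alpha>) - real (Suc m) * \<alpha>"
    using assms by (simp add: of_nat_diff algebra_simps)
  also have "real (m + 2) * \<alpha> - \<alpha> = real (Suc m) * \<alpha>" by (simp add: algebra_simps)
  finally have sum: "2 * sin \<alpha> * (\<Sum>i<N - m. cos (real (m + 2) * \<alpha> + 2 * real i * \<alpha>))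
      = - 2 * sin (real (Suc m) * \<alpha>)"
    unfolding M\<alpha> sin_2pi_minus by simp
  have "2 * autocorr (\<lambda>i. sin (real (Suc i) * \<alpha>)) N m
      = (\<Sum>i<N - m. cos (real m * \<alpha>) - cos (real (m + 2) * \<alpha> + 2 * real i * \<alpha>))"
    unfolding autocorr_def sum_distrib_left
  proof (rule sum.cong[OF refl])
    fix i
    have "real (Suc i) * \<alpha> - real (Suc (i + m)) * \<alpha> = - (real m * \<alpha>)"
      "real (Suc i) * \<alpha> + real (Suc (i + m)) * \<alpha> = real (m + 2) * \<alpha> + 2 * real i * \<alpha>"
      by (simp_all add: algebra_simps)
    then show "2 * (sin (real (Suc i) * \<alpha>) * sin (real (Suc (i + m)) * \<alpha>))
        = cos (real m * \<alpha>) - cos (real (m + 2) * \<alpha> + 2 * real i * \<alpha>)"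
      by (simp only: sin_times_sin cos_minus) simp
  qed
  also have "\<dots> = real (N - m) * cos (real m * \<alpha>) - (\<Sum>i<N - m. cos (real (m + 2) * \<alpha> + 2 * real i * \<alpha>))"
    by (simp add: sum_subtractf)
  finally have "2 * sin \<alpha> * autocorr (\<lambda>i. sin (real (Suc i) * \<alpha>)) N m
      = sin \<alpha> * (real (N - m) * cos (real m * \<alpha>)) + sin (real (Suc m) * \<alpha>)"
    using sum by algebra
  also have "sin (real (Suc m) * \<alpha>) = sin (real m * \<alpha>) * cos \<alpha> + cos (real m * \<alpha>) * sin \<alpha>"
    unfolding sin_add[symmetric] by (simp add: algebra_simps)
  finally show ?thesis
    using assms unfolding fejer_coeff_def \<alpha>_def[symmetric] by (simp add: of_nat_diff algebra_simps)
qed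

lemma cosine_poly_cong: "(\<And>m. m \<le> n \<Longrightarrow> r m = r' m) \<Longrightarrow> cosine_poly r n \<psi> = cosine_poly r' n \<psi>"
  by (simp add: cosine_poly_def)

lemma cosine_poly_scale: "cosine_poly (\<lambda>m. c * r m) n \<psi> = c * cosine_poly r n \<psi>"
  by (simp add: cosine_poly_def sum_distrib_left algebra_simps)

lemma sin_pi_over_Suc_pos: "N \<ge> 1 \<Longrightarrow> sin (pi / real (Suc N)) > 0"
  by (intro sin_gt_zero) (simp_all add: field_simps)

lemma cosine_poly_fejer_coeff_nonneg:
  assumes "N \<ge> 1"
  shows "cosine_poly (fejer_coeff N) N \<psi> \<ge> 0"
proof -
  have "cosine_poly (fejer_coeff N) N \<psi>
      = 2 * sin (pi / real (Suc N)) * cosine_poly (autocorr (\<lambda>i. sin (real (Suc i) * (pi / real (Suc N)))) N) N \<psi>"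
    unfolding cosine_poly_scale[symmetric] using assms by (intro cosine_poly_cong fejer_coeff_eq_autocorr)
  then show ?thesis
    using sin_pi_over_Suc_pos[OF assms] by (simp add: cosine_poly_autocorr)
qed

section \<open>Derivatives of Chebyshev polynomials at the extremal angle\<close>

text \<open>Differentiate \<open>chebyshev_U_mult_sin\<close> in \<open>t\<close> and eliminate the value of the polynomial; the extra factors
  of \<open>sin t\<close> clear all denominators.\<close>

lemma pderiv_chebyshev_U_cos:
  "poly (pderiv (chebyshev_U n)) (cos t) * sin t ^ 3
    = sin (real (n + 1) * t) * cos t - real (n + 1) * cos (real (n + 1) * t) * sin t"
proof -
  have "((\<lambda>t. poly (chebyshev_U n) (cos t) * sin t) has_real_derivative
      poly (pderiv (chebyshev_U n)) (cos t) * (- sin t) * sin t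
          + poly (chebyshev_U n) (cos t) * cos t) (at t)"
    by (rule derivative_eq_intros DERIV_chain2[OF poly_DERIV] refl)+ simp
  moreover have "((\<lambda>t. poly (chebyshev_U n) (cos t) * sin t) has_real_derivative
      real (n + 1) * cos (real (n + 1) * t)) (at t)"
    unfolding chebyshev_U_mult_sin by (auto intro!: derivative_eq_intros)
  ultimately have "poly (pderiv (chebyshev_U n)) (cos t) * (- sin t) * sin t
      + poly (chebyshev_U n) (cos t) * cos t
      = real (n + 1) * cos (real (n + 1) * t)"
    by (rule DERIV_unique)
  then have "poly (pderiv (chebyshev_U n)) (cos t) * sin t ^ 3
      = (poly (chebyshev_U n) (cos t) * sin t) * cos t - real (n + 1) * cos (real (n + 1) * t) * sin t"
    by algebra
  then show ?thesis by (simp only: chebyshev_U_mult_sin)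
qed

text \<open>With \<open>\<alpha> = 2 * \<theta> = pi / (N + 1)\<close> and \<open>\<phi> = (2 * j - 1) * \<theta>\<close>, the angles \<open>(j - 1) * \<alpha>\<close> and \<open>j * \<alpha>\<close> are \<open>\<phi> - \<theta>\<close> and \<open>\<phi> + \<theta>\<close>, while the
  Chebyshev polynomial produces the angle \<open>pi - \<phi>\<close>. Both sides are therefore trigonometric polynomials in
  \<open>\<phi>\<close> and \<open>\<theta>\<close>, equal by the addition theorems.\<close>

lemma fejer_coeff_pair:
  assumes "1 \<le> j" "j \<le> N"
  defines "\<theta> \<equiv> pi / (2 * real N + 2)"
  shows "fejer_coeff N (j - 1) + fejer_coeff N j
    = 2 * (cos \<theta>)\<^sup>2 * sin \<theta> ^ 3 * poly (pderiv (chebyshev_U (2 * (N - j + 1)))) (cos \<theta>)"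
proof -
  define \<phi> where "\<phi> = real (2 * j - 1) * \<theta>"
  have \<alpha>: "pi / real (Suc N) = 2 * \<theta>" by (simp add: \<theta>_def field_simps)
  have j1: "real (j - 1) * (2 * \<theta>) = \<phi> - \<theta>" and j0: "real j * (2 * \<theta>) = \<phi> + \<theta>"
    using assms(1) by (simp_all add: \<phi>_def of_nat_diff algebra_simps)
  have arg: "real (2 * (N - j + 1) + 1) * \<theta> = pi - \<phi>"
  proof -
    have "(2 * real N + 2) * \<theta> = pi" by (simp add: \<theta>_def)
    then show ?thesis using assms(1,2) by (simp add: \<phi>_def of_nat_diff algebra_simps)
  qed
  have A: "poly (pderiv (chebyshev_U (2 * (N - j + 1)))) (cos \<theta>) * sin \<theta> ^ 3
      = sin \<phi> * cos \<theta> + real (2 * (N - j + 1) + 1) * cos \<phi> * sin \<theta>"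
    unfolding pderiv_chebyshev_U_cos arg by simp
  define k where "k = real (Suc N) - real j"
  have k1: "real (Suc N) - real (j - 1) = k + 1" "real (2 * (N - j + 1) + 1) = 2 * k + 1"
    using assms(1,2) by (simp_all add: k_def of_nat_diff)
  have sc: "(sin \<theta>)\<^sup>2 = 1 - (cos \<theta>)\<^sup>2" by (rule sin_squared_eq)
  have "fejer_coeff N (j - 1) + fejer_coeff N j
      = 2 * (cos \<theta>)\<^sup>2 * (sin \<phi> * cos \<theta> + (2 * k + 1) * cos \<phi> * sin \<theta>)"
    unfolding fejer_coeff_def \<alpha> j1 j0 k1 k_def[symmetric] cos_diff cos_add sin_diff sin_add sin_double cos_double
    using sc by algebra
  then show ?thesis using A unfolding k1 by (simp add: mult_ac)
qed

section \<open>Admissible polynomials and nonnegative cosine polynomials\<close>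

text \<open>By the product formula each \<open>2 * cos s * cos (2 * m * s)\<close> splits into the two neighbouring odd
  frequencies; the last one survives as a boundary term until \<open>r n = 0\<close> is imposed.\<close>

lemma cos_mult_cosine_poly:
  "cos s * cosine_poly r n (2 * s)
    = (\<Sum>j=1..n. (r (j - 1) + r j) * cos (real (2 * j - 1) * s)) + r n * cos (real (2 * n + 1) * s)"
proof (induction n)
  case 0
  then show ?case by (simp add: cosine_poly_def)
next
  case (Suc n)
  have prod_to_sum: "2 * (cos s * cos (real (Suc n) * (2 * s))) = cos (real (2 * n + 1) * s)
      + cos (real (2 * Suc n + 1) * s)"
  proof -
    have args: "real (Suc n) * (2 * s) - s = real (2 * n + 1) * s" "real (Suc n) * (2 * s) + s
        = real (2 * Suc n + 1) * s"
      by (simp_all add: algebra_simps)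
    show ?thesis
      using cos_times_cos[of "real (Suc n) * (2 * s)" s] unfolding args by (simp add: mult.commute)
  qed
  have "cos s * cosine_poly r (Suc n) (2 * s) = cos s * cosine_poly r n (2 * s)
      + r (Suc n) * (2 * (cos s * cos (real (Suc n) * (2 * s))))"
    by (simp add: cosine_poly_def) (simp add: algebra_simps)
  also have "\<dots> = cos s * cosine_poly r n (2 * s)
      + r (Suc n) * (cos (real (2 * n + 1) * s) + cos (real (2 * Suc n + 1) * s))"
    by (simp only: prod_to_sum)
  also have "\<dots> = (\<Sum>j=1..Suc n. (r (j - 1) + r j) * cos (real (2 * j - 1) * s))
      + r (Suc n) * cos (real (2 * Suc n + 1) * s)"
    unfolding Suc by (simp add: algebra_simps)
  finally show ?case .
qed

lemma Re_odd_poly_cis: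
  "Re (poly (odd_poly N a) (cis s)) = (\<Sum>j=1..N. a j * cos (real (2 * j - 1) * s))"
proof -
  have "Re (cis s ^ n) = cos (real n * s)" for n
    by (simp only: Complex.DeMoivre cis.sel)
  then show ?thesis
    unfolding poly_odd_poly by simp
qed

lemma odd_poly_minus: "poly (odd_poly N a) (- w) = - poly (odd_poly N a) w"
proof -
  have "(- w) ^ (2 * j - 1) = - (w ^ (2 * j - 1))" if "j \<in> {1..N}" for j
    using that by (intro power_minus_odd) auto
  then show ?thesis
    unfolding poly_odd_poly by (simp add: sum_negf)
qed

lemma odd_poly_cnj: "poly (odd_poly N a) (cnj w) = cnj (poly (odd_poly N a) w)"
  by (simp add: poly_odd_poly)

lemma Re_odd_poly_imaginary:
  assumes "Re w = 0"
  shows "Re (poly (odd_poly N a) w) = 0"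
proof -
  have "cnj w = - w" using assms by (simp add: complex_eq_iff)
  then have "cnj (poly (odd_poly N a) w) = - poly (odd_poly N a) w"
    by (metis odd_poly_cnj odd_poly_minus)
  then have "Re (cnj (poly (odd_poly N a) w)) = Re (- poly (odd_poly N a) w)" by (rule arg_cong)
  then show ?thesis by simp
qed

lemma coeff_odd_poly_1:
  assumes "N \<ge> 1"
  shows "coeff (odd_poly N a) 1 = of_real (a 1)"
proof -
  have "(if 2 * j - 1 = 1 then of_real (a j) else 0) = (if j = 1 then of_real (a j) else (0::complex))"
    if "j \<in> {1..N}" for j
    using that by (intro if_cong) auto
  then have "coeff (odd_poly N a) 1 = (\<Sum>j\<in>{1..N}. if j = 1 then of_real (a j) else 0)"
    unfolding odd_poly_def coeff_sum coeff_monom by (intro sum.cong refl)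
  then show ?thesis using assms by simp
qed

text \<open>The substitution \<open>w = - \<i> * z\<close> exchanges \<open>Im z\<close> with \<open>Re w\<close>. Reality on the real diameter is automatic,
  because an odd real polynomial is purely imaginary on the imaginary axis.\<close>

lemma typically_real_rotate_iff:
  "typically_real (smult \<i> (pcompose (odd_poly N a) [:0, - \<i>:]))
    \<longleftrightarrow> (\<forall>w\<in>ball 0 1. Re w \<noteq> 0 \<longrightarrow> Re (poly (odd_poly N a) w) * Re w > 0)"
  (is "typically_real ?G \<longleftrightarrow> ?half_planes")
proof -
  have G: "poly ?G z = \<i> * poly (odd_poly N a) (- \<i> * z)" for z
    by (simp add: poly_pcompose mult.commute)
  have real: "poly ?G (of_real x) \<in> \<real>" for x
    unfolding G using Re_odd_poly_imaginary[of "- \<i> * of_real x" N a] by (simp add: complex_is_Real_iff)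
  have set: "ball 0 1 - complex_of_real ` {-1<..<1} = {z. cmod z < 1 \<and> Im z \<noteq> 0}"
  proof (intro set_eqI iffI)
    fix z assume z: "z \<in> ball 0 1 - complex_of_real ` {-1<..<1}"
    have "Im z \<noteq> 0"
    proof
      assume im: "Im z = 0"
      have "\<bar>Re z\<bar> < 1" using z abs_Re_le_cmod[of z] by simp
      moreover have "z = of_real (Re z)" using im by (simp add: complex_eq_iff)
      ultimately show False using z
          by (metis DiffD2 abs_less_iff greaterThanLessThan_iff image_eqI minus_less_iff)
    qed
    then show "z \<in> {z. cmod z < 1 \<and> Im z \<noteq> 0}" using z by simp
  qed auto
  have "typically_real ?G \<longleftrightarrow> (\<forall>z. cmod z < 1 \<and> Im z \<noteq> 0 \<longrightarrow> Re (poly (odd_poly N a) (- \<i> * z)) * Im z > 0)"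
    using real unfolding typically_real_def set G by simp
  also have "\<dots> \<longleftrightarrow> ?half_planes"
  proof (intro iffI allI ballI impI)
    fix w :: complex
    assume *: "\<forall>z. cmod z < 1 \<and> Im z \<noteq> 0 \<longrightarrow> Re (poly (odd_poly N a) (- \<i> * z)) * Im z > 0"
      and w: "w \<in> ball 0 1" "Re w \<noteq> 0"
    have "cmod (\<i> * w) < 1" "Im (\<i> * w) = Re w" "- \<i> * (\<i> * w) = w"
      using w by (simp_all add: norm_mult flip: mult.assoc)
    with * w show "Re (poly (odd_poly N a) w) * Re w > 0" by metis
  next
    fix z :: complex
    assume *: ?half_planes and z: "cmod z < 1 \<and> Im z \<noteq> 0"
    have "- \<i> * z \<in> ball 0 1" "Re (- \<i> * z) = Im z"
      using z by (simp_all add: norm_mult)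
    with * z show "Re (poly (odd_poly N a) (- \<i> * z)) * Im z > 0" by metis
  qed
  finally show ?thesis .
qed

text \<open>Radial limit of the inequality inside the disc.\<close>

lemma boundary_sign_from_disc:
  assumes "\<forall>w\<in>ball 0 1. Re w \<noteq> 0 \<longrightarrow> Re (poly p w) * Re w > 0"
  shows "Re (poly p (cis s)) * cos s \<ge> 0"
proof (cases "cos s = 0")
  case False
  have "((\<lambda>\<rho>. Re (poly p (of_real \<rho> * cis s)) * (\<rho> * cos s)) \<longlongrightarrow> Re (poly p (of_real 1 * cis s)) * (1 * cos s)) (at_left 1)"
    by (intro tendsto_intros)
  moreover have "\<forall>\<^sub>F \<rho> in at_left 1. 0 \<le> Re (poly p (of_real \<rho> * cis s)) * (\<rho> * cos s)"
  proof -
    have "\<forall>\<^sub>F \<rho> in at_left 1. \<rho> \<in> {0<..<1::real}" by (rule eventually_at_left_real) simp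
    then show ?thesis
    proof eventually_elim
      case (elim \<rho>)
      then have "of_real \<rho> * cis s \<in> ball 0 1" "Re (of_real \<rho> * cis s) = \<rho> * cos s" "\<rho> * cos s \<noteq> 0"
        using False by (auto simp: norm_mult)
      with assms show ?case by (metis less_imp_le)
    qed
  qed
  ultimately show ?thesis
    using tendsto_lowerbound[of _ _ "at_left (1::real)" 0] by force
qed simp

lemma isCont_cosine_poly: "isCont (cosine_poly r n) x"
  using cosine_poly_has_derivative by (rule DERIV_isCont)

text \<open>The factor can be cancelled away from its zeros, and continuity covers these isolated points.\<close>

lemma cosine_poly_nonneg_if_square_mult:
  assumes "\<And>s. (cos s)\<^sup>2 * cosine_poly r n (2 * s) \<ge> 0"
  shows "cosine_poly r n \<psi> \<ge> 0"
proof -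
  have nz: "cosine_poly r n x \<ge> 0" if "cos (x / 2) \<noteq> 0" for x
    using assms[of "x / 2"] that by (simp add: zero_le_mult_iff)
  show ?thesis
  proof (cases "cos (\<psi> / 2) = 0")
    case True
    then have sin: "sin (\<psi> / 2) \<noteq> 0" using sin_zero_abs_cos_one[of "\<psi> / 2"] by auto
    \<comment> \<open>Zeros of \<open>cos (x / 2)\<close> are \<open>2 * pi\<close> apart.\<close>
    have "\<forall>\<^sub>F x in at_right \<psi>. x \<in> {\<psi><..<\<psi> + 2 * pi}"
      by (rule eventually_at_right_real) simp
    then have "\<forall>\<^sub>F x in at_right \<psi>. cosine_poly r n x \<ge> 0"
    proof eventually_elim
      case (elim x)
      have "cos (x / 2) = cos (\<psi> / 2 + (x - \<psi>) / 2)" by (simp add: field_simps)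
      also have "\<dots> = - (sin (\<psi> / 2) * sin ((x - \<psi>) / 2))" by (simp add: cos_add True)
      finally have "cos (x / 2) \<noteq> 0"
        using sin sin_gt_zero[of "(x - \<psi>) / 2"] elim by auto
      then show ?case by (rule nz)
    qed
    moreover have "(cosine_poly r n \<longlongrightarrow> cosine_poly r n \<psi>) (at_right \<psi>)"
      using isCont_cosine_poly[of \<psi> r n] by (simp add: isCont_def filterlim_at_split)
    ultimately show ?thesis
      by (intro tendsto_lowerbound[of "cosine_poly r n" _ "at_right \<psi>"]) auto
  qed (rule nz)
qed

text \<open>The boundary of the right half disc consists of a semicircle and a piece of the imaginary axis, where
  \<open>Re p\<close> is nonnegative; the maximum principle for \<open>- p\<close> gives \<open>Re p \<ge> 0\<close> inside. The inequality is strict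
  because the image of the half disc under the nonconstant \<open>p\<close> is open.\<close>

lemma half_disc_minimum_principle:
  assumes bdry: "\<And>s. cos s \<ge> 0 \<Longrightarrow> Re (poly p (cis s)) \<ge> 0"
    and axis: "\<And>w. Re w = 0 \<Longrightarrow> Re (poly p w) = 0"
    and nonconst: "coeff p 1 \<noteq> 0"
    and w: "cmod w < 1" "Re w > 0"
  shows "Re (poly p w) > 0"
proof -
  define S where "S = ball (0::complex) 1 \<inter> {z. 0 < Re z}"
  have S: "open S" "convex S" "bounded S" "w \<in> S"
    using w by (auto simp: S_def open_halfspace_Re_gt convex_halfspace_Re_gt
        intro!: open_Int convex_Int bounded_Int)
  have hol: "poly p holomorphic_on A" for A by (intro holomorphic_intros)
  have clos: "closure S \<subseteq> cball 0 1 \<inter> {z. 0 \<le> Re z}"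
    by (rule closure_minimal) (auto simp: S_def closed_halfspace_Re_ge intro!: closed_Int)
  have nonneg: "Re (poly p z) \<ge> 0" if "z \<in> S" for z
  proof -
    have "Re (- poly p z) \<le> 0"
    proof (rule maximum_real_frontier[of "\<lambda>z. - poly p z" S])
      show "(\<lambda>z. - poly p z) holomorphic_on interior S" by (intro holomorphic_intros hol)
      show "continuous_on (closure S) (\<lambda>z. - poly p z)" by (intro continuous_intros)
      fix z assume "z \<in> frontier S"
      then have "z \<in> closure S" "z \<notin> S" using S(1) by (auto simp: frontier_def interior_open)
      then have z: "cmod z \<le> 1" "Re z \<ge> 0" "cmod z = 1 \<or> Re z = 0"
        using clos by (auto simp: S_def)
      show "Re (- poly p z) \<le> 0"
      proof (cases "Re z = 0")
        case True
        then show ?thesis using axis by simp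
      next
        case False
        then have "cmod z = 1" using z by simp
        then have "cis (Arg z) = z" using rcis_cmod_Arg[of z] by (simp add: rcis_def)
        moreover from this have "cos (Arg z) = Re z" by (metis cis.sel(1))
        ultimately show ?thesis using bdry[of "Arg z"] z by simp
      qed
    qed (use S that in auto)
    then show ?thesis by simp
  qed
  have "\<not> poly p constant_on S"
  proof
    assume "poly p constant_on S"
    then obtain c where c: "\<And>z. z \<in> S \<Longrightarrow> poly p z = c" by (auto simp: constant_on_def)
    have "infinite S" using S finite_imp_not_open by blast
    then have "infinite {z. poly (p - [:c:]) z = 0}"
      using c by (elim infinite_super[rotated]) auto
    then have "p - [:c:] = 0" using poly_roots_finite by blast
    then have "coeff p 1 = coeff [:c:] 1" by simp
    then show False using nonconst by simp
  qed
  then have "open (poly p ` S)"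
    using S by (intro open_mapping_thm[of _ S]) (auto intro: hol convex_connected)
  then obtain e where e: "e > 0" "ball (poly p w) e \<subseteq> poly p ` S"
    using S(4) by (meson open_contains_ball imageI)
  \<comment> \<open>Moving to the left inside an image ball around \<open>poly p w\<close> leaves room below \<open>Re (poly p w)\<close>.\<close>
  have "poly p w - of_real (e / 2) \<in> ball (poly p w) e"
    using e(1) by (simp add: dist_norm norm_divide)
  then obtain z where "z \<in> S" "poly p w - of_real (e / 2) = poly p z"
    using e(2) by blast
  then have "Re (poly p w - of_real (e / 2)) \<ge> 0"
    using nonneg[of z] by (simp only:)
  then show ?thesis using e(1) by simp
qed

lemma odd_poly_in_T_set_iff:
  assumes N: "N \<ge> 1" and a1: "a 1 = 1" and rN: "r N = 0"
    and a: "\<And>j. j \<in> {1..N} \<Longrightarrow> a j = r (j - 1) + r j"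
  shows "odd_poly N a \<in> T_set N \<longleftrightarrow> (\<forall>\<psi>. cosine_poly r N \<psi> \<ge> 0)"
proof -
  have bdry: "Re (poly (odd_poly N a) (cis s)) = cos s * cosine_poly r N (2 * s)" for s
    unfolding Re_odd_poly_cis cos_mult_cosine_poly rN using a by simp
  have T: "odd_poly N a \<in> T_set N \<longleftrightarrow>
      (\<forall>w\<in>ball 0 1. Re w \<noteq> 0 \<longrightarrow> Re (poly (odd_poly N a) w) * Re w > 0)"
    unfolding T_set_def mem_Collect_eq typically_real_rotate_iff using a1 by blast
  show ?thesis
  proof
    assume "odd_poly N a \<in> T_set N"
    then have "Re (poly (odd_poly N a) (cis s)) * cos s \<ge> 0" for s
      unfolding T by (rule boundary_sign_from_disc)
    then have "(cos s)\<^sup>2 * cosine_poly r N (2 * s) \<ge> 0" for s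
      unfolding bdry by (simp add: power2_eq_square mult_ac)
    then show "\<forall>\<psi>. cosine_poly r N \<psi> \<ge> 0"
      using cosine_poly_nonneg_if_square_mult by blast
  next
    assume nonneg: "\<forall>\<psi>. cosine_poly r N \<psi> \<ge> 0"
    have pos: "Re (poly (odd_poly N a) w) > 0" if "cmod w < 1" "Re w > 0" for w
    proof (rule half_disc_minimum_principle[OF _ _ _ that])
      show "Re (poly (odd_poly N a) (cis s)) \<ge> 0" if "cos s \<ge> 0" for s
        unfolding bdry using that nonneg by simp
      show "coeff (odd_poly N a) 1 \<noteq> 0"
        using coeff_odd_poly_1[OF N, of a] a1 by simp
    qed (rule Re_odd_poly_imaginary)
    show "odd_poly N a \<in> T_set N"
      unfolding T
    proof (intro ballI impI)
      fix w assume w: "w \<in> ball 0 (1::real)" "Re w \<noteq> 0"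
      show "Re (poly (odd_poly N a) w) * Re w > 0"
      proof (cases "Re w > 0")
        case True
        then show ?thesis using pos[of w] w by simp
      next
        case False
        then have "Re (poly (odd_poly N a) (- w)) > 0" using pos[of "- w"] w by simp
        then show ?thesis using False w by (simp add: odd_poly_minus mult_neg_neg)
      qed
    qed
  qed
qed

text \<open>Starting from \<open>r N = 0\<close>, the equations are solved downwards by alternating tail sums of \<open>a\<close>.\<close>

lemma ex_adjacent_sum_rep:
  fixes a :: "nat \<Rightarrow> real"
  shows "\<exists>r. r N = 0 \<and> (\<forall>j\<in>{1..N}. a j = r (j - 1) + r j)"
proof -
  define r where "r m = (\<Sum>i<N - m. (-1) ^ i * a (m + 1 + i))" for m
  have "a j = r (j - 1) + r j" if "j \<in> {1..N}" for j
  proof -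
    have "N - (j - 1) = Suc (N - j)" "j - 1 + 1 = j" using that by auto
    then have "r (j - 1) = (\<Sum>i<Suc (N - j). (-1) ^ i * a (j + i))"
      by (simp only: r_def)
    also have "\<dots> = a j - r j"
      by (simp add: sum.lessThan_Suc_shift r_def sum_negf del: sum.lessThan_Suc)
    finally show ?thesis by simp
  qed
  moreover have "r N = 0" by (simp add: r_def)
  ultimately show ?thesis by blast
qed

lemma alternating_sum_adjacent:
  fixes r :: "nat \<Rightarrow> real"
  shows "(\<Sum>j=1..n. (-1) ^ (j + 1) * (r (j - 1) + r j)) = r 0 - (-1) ^ n * r n"
  by (induction n) (simp_all add: algebra_simps)

lemma odd_poly_at_ii_adjacent:
  assumes "r N = 0" "\<And>j. j \<in> {1..N} \<Longrightarrow> a j = r (j - 1) + r j"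
  shows "- \<i> * poly (odd_poly N a) \<i> = of_real (r 0)"
proof -
  have "(\<Sum>j=1..N. (-1) ^ (j + 1) * a j) = (\<Sum>j=1..N. (-1) ^ (j + 1) * (r (j - 1) + r j))"
    using assms(2) by (intro sum.cong) auto
  then show ?thesis unfolding odd_poly_at_ii alternating_sum_adjacent assms(1) by simp
qed

lemma odd_poly_cong: "(\<And>j. j \<in> {1..N} \<Longrightarrow> a j = b j) \<Longrightarrow> odd_poly N a = odd_poly N b"
  unfolding odd_poly_def by (intro sum.cong refl) simp

section \<open>The extremal polynomial\<close>

text \<open>Scaled such that the first two coefficients add up to \<open>1\<close>, which is the condition \<open>a 1 = 1\<close>.\<close>

definition extremal_coeff :: "nat \<Rightarrow> nat \<Rightarrow> real" where
  "extremal_coeff N m = fejer_coeff N m / (fejer_coeff N 0 + fejer_coeff N 1)"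

lemma fejer_coeff_0: "fejer_coeff N 0 = real (Suc N) * sin (pi / real (Suc N))"
  by (simp add: fejer_coeff_def)

lemma fejer_coeff_0_1:
  "fejer_coeff N 0 + fejer_coeff N 1 = real (Suc N) * sin (pi / real (Suc N)) * (1 + cos (pi / real (Suc N)))"
  by (simp add: fejer_coeff_def algebra_simps)

lemma one_plus_cos_pi_over_Suc_pos: "N \<ge> 1 \<Longrightarrow> 1 + cos (pi / real (Suc N)) > 0"
  using cos_ge_zero[of "pi / real (Suc N)"] by (simp add: field_simps)

lemma fejer_coeff_0_1_pos: "N \<ge> 1 \<Longrightarrow> fejer_coeff N 0 + fejer_coeff N 1 > 0"
  unfolding fejer_coeff_0_1 using sin_pi_over_Suc_pos[of N] one_plus_cos_pi_over_Suc_pos[of N] by simp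

lemma extremal_coeff_0: "N \<ge> 1 \<Longrightarrow> extremal_coeff N 0 = 1 / (1 + cos (pi / real (Suc N)))"
  unfolding extremal_coeff_def fejer_coeff_0_1 unfolding fejer_coeff_0 using sin_pi_over_Suc_pos[of N]
  by (simp del: of_nat_Suc)

lemma extremal_coeff_N: "N \<ge> 1 \<Longrightarrow> extremal_coeff N N = 0"
proof -
  have "fejer_coeff N N = sin (real N * (pi / real (Suc N)) + pi / real (Suc N))"
    unfolding fejer_coeff_def sin_add by simp
  also have "real N * (pi / real (Suc N)) + pi / real (Suc N) = real (Suc N) * (pi / real (Suc N))"
    unfolding of_nat_Suc by algebra
  also have "\<dots> = pi" by simp
  finally show ?thesis by (simp add: extremal_coeff_def)
qed

text \<open>The positive factor of \<open>fejer_coeff_pair\<close> is the same for all \<open>j\<close>, so it cancels in the quotients of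
  derivatives.\<close>

lemma F_ext_eq_adjacent_sums:
  assumes "N \<ge> 1"
  shows "F_ext N = odd_poly N (\<lambda>j. extremal_coeff N (j - 1) + extremal_coeff N j)"
  unfolding F_ext_def
proof (rule odd_poly_cong)
  fix j assume j: "j \<in> {1..N}"
  define \<theta> where "\<theta> = pi / (2 * real N + 2)"
  let ?U = "\<lambda>j. poly (pderiv (chebyshev_U (2 * (N - j + 1)))) (cos \<theta>)"
  have pair: "fejer_coeff N (i - 1) + fejer_coeff N i = 2 * (cos \<theta>)\<^sup>2 * sin \<theta> ^ 3 * ?U i" if "1 \<le> i"
      "i \<le> N" for i
    unfolding \<theta>_def by (rule fejer_coeff_pair[OF that])
  have "2 * (cos \<theta>)\<^sup>2 * sin \<theta> ^ 3 * ?U 1 > 0"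
    using pair[of 1] fejer_coeff_0_1_pos[OF assms] assms by simp
  then have c: "2 * (cos \<theta>)\<^sup>2 * sin \<theta> ^ 3 \<noteq> 0" by auto
  have "extremal_coeff N (j - 1) + extremal_coeff N j
      = (fejer_coeff N (j - 1) + fejer_coeff N j) / (fejer_coeff N (1 - 1) + fejer_coeff N 1)"
    by (simp add: extremal_coeff_def add_divide_distrib)
  also have "\<dots> = ?U j / ?U 1"
    using j assms c by (subst (1 2) pair) (auto simp del: mult_eq_0_iff)
  also have "?U 1 = poly (pderiv (chebyshev_U (2 * N))) (cos \<theta>)"
    using assms by simp
  finally show "?U j / poly (pderiv (chebyshev_U (2 * N))) (cos \<theta>) = extremal_coeff N (j - 1)
      + extremal_coeff N j" ..
qed

text \<open>With \<open>v = r 0\<close> this is Fejer's inequality under the constraint \<open>r 0 + r 1 = 1\<close>. The least value of \<open>v\<close>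
  forces equality in it, hence determines \<open>r\<close>.\<close>

lemma T_set_value_bound:
  assumes N: "N \<ge> 1" and F: "F \<in> T_set N"
  obtains v where "- \<i> * poly F \<i> = of_real v" "extremal_coeff N 0 \<le> v" "v = extremal_coeff N 0 \<Longrightarrow> F
      = F_ext N"
proof -
  define \<alpha> where "\<alpha> = pi / real (Suc N)"
  obtain a where a1: "a 1 = 1" and Fa: "F = odd_poly N a" using F by (auto simp: T_set_def)
  obtain r where rN: "r N = 0" and ar: "\<And>j. j \<in> {1..N} \<Longrightarrow> a j = r (j - 1) + r j"
    using ex_adjacent_sum_rep[of N a] by blast
  have nonneg: "cosine_poly r N \<psi> \<ge> 0" for \<psi>
    using F odd_poly_in_T_set_iff[of N a r, OF N a1 rN ar] Fa by blast
  have r01: "r 0 + r 1 = 1" using ar[of 1] a1 N by simp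
  have r1: "r 1 \<le> cos \<alpha> * r 0"
    unfolding \<alpha>_def using fejer_inequality[of N r, OF N rN nonneg] .
  have pos: "1 + cos \<alpha> > 0" using one_plus_cos_pi_over_Suc_pos[OF N] by (simp add: \<alpha>_def)
  have e0: "extremal_coeff N 0 = 1 / (1 + cos \<alpha>)" using extremal_coeff_0[OF N] by (simp add: \<alpha>_def)
  have "F = F_ext N" if v: "r 0 = extremal_coeff N 0"
  proof -
    have "r 0 * (1 + cos \<alpha>) = 1" using pos by (simp add: v e0)
    then have eq: "r 1 = cos \<alpha> * r 0" using r01 by (simp add: algebra_simps)
    have "r j = extremal_coeff N j" if "j \<le> N" for j
    proof -
      have "real (Suc N) * sin \<alpha> * r j = r 0 * fejer_coeff N j"
        using fejer_equality[of N r, OF N rN nonneg eq[unfolded \<alpha>_def] that] by (simp only: \<alpha>_def)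
      moreover have "r 0 * fejer_coeff N j = real (Suc N) * sin \<alpha> * extremal_coeff N j"
        using sin_pi_over_Suc_pos[OF N] pos
        unfolding v e0 extremal_coeff_def[of N j] fejer_coeff_0_1 \<alpha>_def[symmetric] by (simp del: of_nat_Suc)
      ultimately show ?thesis
        using sin_pi_over_Suc_pos[OF N] by (simp add: \<alpha>_def del: of_nat_Suc)
    qed
    then show ?thesis
      unfolding Fa F_ext_eq_adjacent_sums[OF N] using ar by (intro odd_poly_cong) auto
  qed
  moreover have "extremal_coeff N 0 \<le> r 0"
    using r1 r01 pos unfolding e0 by (simp add: divide_le_eq algebra_simps)
  moreover have "- \<i> * poly F \<i> = of_real (r 0)"
    unfolding Fa by (rule odd_poly_at_ii_adjacent[OF rN ar])
  ultimately show thesis using that by blast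
qed

lemma F_ext_in_T_set:
  assumes N: "N \<ge> 1"
  shows "F_ext N \<in> T_set N"
proof -
  have "extremal_coeff N = (\<lambda>m. (1 / (fejer_coeff N 0 + fejer_coeff N 1)) * fejer_coeff N m)"
    by (simp add: extremal_coeff_def fun_eq_iff)
  then have nonneg: "cosine_poly (extremal_coeff N) N \<psi> \<ge> 0" for \<psi>
    using cosine_poly_fejer_coeff_nonneg[OF N] fejer_coeff_0_1_pos[OF N]
        by (simp only: cosine_poly_scale) simp
  have "extremal_coeff N (1 - 1) + extremal_coeff N 1 = 1"
    using fejer_coeff_0_1_pos[OF N] by (simp add: extremal_coeff_def flip: add_divide_distrib)
  then show ?thesis
    unfolding F_ext_eq_adjacent_sums[OF N]
   
        by (subst odd_poly_in_T_set_iff[where r = "extremal_coeff N"]) (use N nonneg extremal_coeff_N[OF N] in auto)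
qed

lemma F_ext_value:
  assumes "N \<ge> 1"
  shows "- \<i> * poly (F_ext N) \<i> = of_real (extremal_coeff N 0)"
  unfolding F_ext_eq_adjacent_sums[OF assms]
      by (rule odd_poly_at_ii_adjacent) (use extremal_coeff_N[OF assms] in auto)

lemma extremal_value_sec:
  assumes "N \<ge> 1"
  shows "extremal_coeff N 0 = 1 / 2 * (1 / cos (pi / (2 * real N + 2)))\<^sup>2"
proof -
  have "pi / real (Suc N) = 2 * (pi / (2 * real N + 2))" by (simp add: field_simps)
  then have "cos (pi / real (Suc N)) = 2 * (cos (pi / (2 * real N + 2)))\<^sup>2 - 1"
    by (simp only: cos_double_cos)
  then show ?thesis
    using extremal_coeff_0[OF assms] by (simp add: power_divide)
qed

theorem theorem1:
  fixes N :: nat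
  assumes "N \<ge> 1"
  shows "F_ext N \<in> T_set N \<and>
    (\<exists>F\<in>T_set N. - \<i> * poly F \<i> = complex_of_real (J_min N)) \<and>
    J_min N = (LEAST m. \<exists>a. a 1 = 1 \<and> odd_poly N a \<in> T_set N \<and>
                           m = (\<Sum>j=1..N. (-1) ^ (j + 1) * a j)) \<and>
    J_min N = 1 / 2 * (1 / cos (pi / (2 * real N + 2)))\<^sup>2 \<and>
    complex_of_real (J_min N) = - \<i> * poly (F_ext N) \<i> \<and>
    (\<forall>F\<in>T_set N. - \<i> * poly F \<i> \<in> \<real> \<and>
                  Re (- \<i> * poly (F_ext N) \<i>) \<le> Re (- \<i> * poly F \<i>)) \<and>
    (\<forall>F\<in>T_set N. - \<i> * poly F \<i> = complex_of_real (J_min N) \<longrightarrow> F = F_ext N)"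
proof -
  let ?v = "extremal_coeff N 0"
  note mem = F_ext_in_T_set[OF assms] and val = F_ext_value[OF assms]
  have bound: "?v \<le> m" if "F \<in> T_set N" "- \<i> * poly F \<i> = of_real m" for F m
    using T_set_value_bound[OF assms that(1)] that(2) by (metis of_real_eq_iff)
  have unique: "F = F_ext N" if "F \<in> T_set N" "- \<i> * poly F \<i> = of_real ?v" for F
    using T_set_value_bound[OF assms that(1)] that(2) by (metis of_real_eq_iff)
  have J: "J_min N = ?v"
    unfolding J_min_def using mem val bound by (intro Least_equality) blast+
  have least: "(LEAST m. \<exists>a. a 1 = 1 \<and> odd_poly N a \<in> T_set N \<and> m = (\<Sum>j=1..N. (-1) ^ (j + 1) * a j)) = ?v"
  proof (rule Least_equality)
    obtain a where a: "a 1 = 1" "F_ext N = odd_poly N a" using mem by (auto simp: T_set_def)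
    then have "of_real ?v = complex_of_real (\<Sum>j=1..N. (-1) ^ (j + 1) * a j)"
      using val odd_poly_at_ii[of N a] by metis
    then show "\<exists>a. a 1 = 1 \<and> odd_poly N a \<in> T_set N \<and> ?v = (\<Sum>j=1..N. (-1) ^ (j + 1) * a j)"
      using a mem by (metis of_real_eq_iff)
  next
    fix m assume "\<exists>a. a 1 = 1 \<and> odd_poly N a \<in> T_set N \<and> m = (\<Sum>j=1..N. (-1) ^ (j + 1) * a j)"
    then show "?v \<le> m" using bound odd_poly_at_ii by blast
  qed
  have "- \<i> * poly F \<i> \<in> \<real> \<and> Re (- \<i> * poly (F_ext N) \<i>) \<le> Re (- \<i> * poly F \<i>)" if F: "F \<in> T_set N" for F
  proof -
    obtain v where v: "- \<i> * poly F \<i> = of_real v" "?v \<le> v"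
      using T_set_value_bound[OF assms F] by blast
    show ?thesis unfolding val v(1) using v(2) by simp
  qed
  note bounds = this
  show ?thesis
    unfolding J least
  proof (intro conjI)
    show "\<exists>F\<in>T_set N. - \<i> * poly F \<i> = of_real ?v" using mem val by blast
    show "of_real ?v = - \<i> * poly (F_ext N) \<i>" using val by (rule sym)
    show "\<forall>F\<in>T_set N. - \<i> * poly F \<i> \<in> \<real> \<and> Re (- \<i> * poly (F_ext N) \<i>) \<le> Re (- \<i> * poly F \<i>)"
      using bounds by blast
    show "\<forall>F\<in>T_set N. - \<i> * poly F \<i> = of_real ?v \<longrightarrow> F = F_ext N" using unique by blast
  qed (rule mem refl extremal_value_sec[OF assms])+
qed

end
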